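(* Let $\Gamma$ be the zero-sum stochastic game ("Big Match") with state space $K=\{\omega,1^*,0^*\}$, action sets $I=\{T,B\}$ for Player 1 and $J=\{L,R\}$ for Player 2, where $1^*$ (resp. $0^*$) is an absorbing state with payoff $1$ (resp. $0$) whatever the actions, and where in state $\omega$: $(T,L)$ gives payoff $1$ and the state moves to $1^*$; $(T,R)$ gives payoff $0$ and the state moves to $0^*$; $(B,L)$ gives payoff $0$ and the state stays $\omega$; $(B,R)$ gives payoff $1$ and the state stays $\omega$. Then, for the game starting in $\omega$, Player 1 cannot guarantee uniformly more than $0$ in the general sense; that is, for every real $\alpha>0$, Player 1 cannot guarantee uniformly in the general sense $\alpha$ in $\Gamma^{\omega}$.
   Context: Notation: $\mathbb{N}=\{0,1,2,\dots\}$, $\mathbb{N}^*=\{1,2,\dots\}$; $\Delta(C)$ is the set of probability measures on $C$. Stochastic game: A finite zero-sum stochastic game $\Gamma$ consists of nonempty finite sets $K$ (states), $I$ (actions of Player 1), $J$ (actions of Player 2), a payoff function $g:K\times I\times J\to[0,1]$ and a transition function $q:K\times I\times J\to\Delta(K)$. In the game $\Gamma^{k_1}$ with initial state $k_1\in K$, at each stage $m\ge1$ the players simultaneously and independently choose $i_m\in I$, $j_m\in J$; the stage payoff (to Player 1) is $g_m=g(k_m,i_m,j_m)$; the next state $k_{m+1}$ is drawn from $q(k_m,i_m,j_m)$, and $(k_{m+1},i_m,j_m)$ is publicly announced. Histories before stage $m$ form $H_m=(K\times I\times J)^{m-1}\times K$. A behavioral strategy of Player 1 (resp. 2) is a map $\sigma:\bigcup_{m\ge1}H_m\to\Delta(I)$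 (resp. $\tau:\bigcup_{m\ge1}H_m\to\Delta(J)$); the sets of these are $\Sigma$, $\mathcal{T}$. A triple $(k_1,\sigma,\tau)$ induces a probability $\mathbb{P}^{k_1}_{\sigma,\tau}$ on infinite plays, with expectation $\mathbb{E}^{k_1}_{\sigma,\tau}$. Definition: Player 1 can guarantee uniformly in the general sense $\alpha\in\mathbb{R}$ in $\Gamma^{k_1}$ if for all $\epsilon>0$ there exist $\sigma^*\in\Sigma$ and $N_1\in\mathbb{N}^*$ such that for all $\tau\in\mathcal{T}$, all $n\ge N_1$ and all $\bar n\in\mathbb{N}$, $$\mathbb{E}^{k_1}_{\sigma^*,\tau}\left(\frac1n\sum_{m=\bar n+1}^{\bar n+n}g_m\right)\ge\alpha-\epsilon.$$ *)

theory Defs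
  imports "HOL-Probability.Probability"
begin

(* Histories before stage m: the m - 1 past triples (state, action of Player 1, action of
   Player 2) in chronological order, together with the current state. *)
type_synonym ('k, 'i, 'j) history = "('k \<times> 'i \<times> 'j) list \<times> 'k"

type_synonym ('k, 'i, 'j, 'a) strategy = "('k, 'i, 'j) history \<Rightarrow> 'a pmf"

(* An infinite play; stages are numbered from 1, and the coordinate n of a play is the
   triple of stage n + 1. *)
type_synonym ('k, 'i, 'j) play = "nat \<Rightarrow> 'k \<times> 'i \<times> 'j"

locale stochastic_game =
  fixes g :: "'k::finite \<times> 'i::finite \<times> 'j::finite \<Rightarrow> real"
    and q :: "'k \<times> 'i \<times> 'j \<Rightarrow> 'k pmf"
  assumes payoff_range: "g z \<in> {0..1}"
begin

definition state_law :: "'k \<Rightarrow> nat \<Rightarrow> ('k, 'i, 'j) play \<Rightarrow> 'k pmf" where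
  "state_law k1 n x = (if n = 0 then return_pmf k1 else q (x (n - 1)))"

(* Conditional law of the triple of stage n + 1 given the first n triples; it reads only the
   coordinates of x below n.  The two actions are drawn independently. *)
definition stage_law ::
  "'k \<Rightarrow> ('k, 'i, 'j, 'i) strategy \<Rightarrow> ('k, 'i, 'j, 'j) strategy
    \<Rightarrow> nat \<Rightarrow> ('k, 'i, 'j) play \<Rightarrow> ('k \<times> 'i \<times> 'j) pmf" where
  "stage_law k1 \<sigma> \<tau> n x =
     bind_pmf (state_law k1 n x) (\<lambda>k.
       let h = (map x [0..<n], k)
       in map_pmf (\<lambda>(i, j). (k, i, j)) (pair_pmf (\<sigma> h) (\<tau> h)))"

lemma Ionescu_Tulcea_stage_law:
  "Ionescu_Tulcea (\<lambda>n x. measure_pmf (stage_law k1 \<sigma> \<tau> n x)) (\<lambda>_. count_space UNIV)"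
proof unfold_locales
  fix n :: nat
  have "PiM {0..<n} (\<lambda>_. count_space (UNIV :: ('k \<times> 'i \<times> 'j) set)) =
      count_space (PiE {0..<n} (\<lambda>_. UNIV))"
    by (intro count_space_PiM_finite) auto
  then show "(\<lambda>x. measure_pmf (stage_law k1 \<sigma> \<tau> n x))
      \<in> measurable (PiM {0..<n} (\<lambda>_. count_space UNIV)) (subprob_algebra (count_space UNIV))"
    by (auto simp: measurable_count_space_eq1 space_subprob_algebra measure_pmf.subprob_space_axioms)
qed

(* The probability on infinite plays: the Ionescu-Tulcea limit of the laws of the stages. *)
definition play_measure ::
  "'k \<Rightarrow> ('k, 'i, 'j, 'i) strategy \<Rightarrow> ('k, 'i, 'j, 'j) strategy \<Rightarrow> ('k, 'i, 'j) play measure" where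
  "play_measure k1 \<sigma> \<tau> =
     projective_family.lim UNIV
       (Ionescu_Tulcea.CI (\<lambda>n x. measure_pmf (stage_law k1 \<sigma> \<tau> n x)) (\<lambda>_. count_space UNIV))
       (\<lambda>_. count_space UNIV)"

lemma sets_play_measure: "sets (play_measure k1 \<sigma> \<tau>) = sets (PiM UNIV (\<lambda>_. count_space UNIV))"
proof -
  interpret Ionescu_Tulcea "\<lambda>n x. measure_pmf (stage_law k1 \<sigma> \<tau> n x)" "\<lambda>_. count_space UNIV"
    by (rule Ionescu_Tulcea_stage_law)
  show ?thesis unfolding play_measure_def by simp
qed

lemma prob_space_play_measure: "prob_space (play_measure k1 \<sigma> \<tau>)"
proof -
  interpret Ionescu_Tulcea "\<lambda>n x. measure_pmf (stage_law k1 \<sigma> \<tau> n x)" "\<lambda>_. count_space UNIV"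
    by (rule Ionescu_Tulcea_stage_law)
  have "prob_space (distr PF.lim (PiM {} (\<lambda>_. count_space UNIV)) (\<lambda>x. restrict x {}))"
    unfolding distr_lim[OF finite.emptyI] by (rule PF.prob_space_P) auto
  then show ?thesis
    unfolding play_measure_def
    by (rule prob_space_distrD[rotated])
      (subst measurable_cong_sets[OF PF.sets_lim refl], rule measurable_restrict_subset, simp)
qed

definition stage_payoff :: "nat \<Rightarrow> ('k, 'i, 'j) play \<Rightarrow> real" where
  "stage_payoff m x = g (x (m - 1))"

definition guarantees_uniformly_general :: "'k \<Rightarrow> real \<Rightarrow> bool" where
  "guarantees_uniformly_general k1 \<alpha> \<longleftrightarrow>
     (\<forall>\<epsilon>>0. \<exists>\<sigma>. \<exists>N1\<ge>1. \<forall>\<tau>. \<forall>n\<ge>N1. \<forall>nbar :: nat.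
        (LINT x | play_measure k1 \<sigma> \<tau>.
           1 / real n * (\<Sum>m = nbar + 1..nbar + n. stage_payoff m x)) \<ge> \<alpha> - \<epsilon>)"

end

(* Absorb1 and Absorb0 are the absorbing states with payoff 1 and 0. *)
datatype bm_state = Omega | Absorb1 | Absorb0
datatype bm_action1 = T | B
datatype bm_action2 = L | R

instance bm_state :: finite
proof
  have "(UNIV :: bm_state set) = {Omega, Absorb1, Absorb0}"
    using bm_state.exhaust by auto
  then show "finite (UNIV :: bm_state set)"
    by (metis finite.emptyI finite.insertI)
qed

instance bm_action1 :: finite
proof
  have "(UNIV :: bm_action1 set) = {T, B}"
    using bm_action1.exhaust by auto
  then show "finite (UNIV :: bm_action1 set)"
    by (metis finite.emptyI finite.insertI)
qed

instance bm_action2 :: finite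
proof
  have "(UNIV :: bm_action2 set) = {L, R}"
    using bm_action2.exhaust by auto
  then show "finite (UNIV :: bm_action2 set)"
    by (metis finite.emptyI finite.insertI)
qed

fun bm_payoff :: "bm_state \<times> bm_action1 \<times> bm_action2 \<Rightarrow> real" where
  "bm_payoff (Omega, T, L) = 1"
| "bm_payoff (Omega, T, R) = 0"
| "bm_payoff (Omega, B, L) = 0"
| "bm_payoff (Omega, B, R) = 1"
| "bm_payoff (Absorb1, _, _) = 1"
| "bm_payoff (Absorb0, _, _) = 0"

fun bm_next :: "bm_state \<times> bm_action1 \<times> bm_action2 \<Rightarrow> bm_state" where
  "bm_next (Omega, T, L) = Absorb1"
| "bm_next (Omega, T, R) = Absorb0"
| "bm_next (Omega, B, _) = Omega"
| "bm_next (Absorb1, _, _) = Absorb1"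
| "bm_next (Absorb0, _, _) = Absorb0"

definition bm_transition :: "bm_state \<times> bm_action1 \<times> bm_action2 \<Rightarrow> bm_state pmf" where
  "bm_transition z = return_pmf (bm_next z)"

interpretation big_match: stochastic_game bm_payoff bm_transition
proof
  show "bm_payoff z \<in> {0..1}" for z
    by (cases z rule: bm_payoff.cases) auto
qed

end

theory Submission
  imports Defs
begin

text \<open>
Suppose that a strategy \<open>\<sigma>\<close> of Player 1 guarantees a positive amount on average over every window
of \<open>N\<close> consecutive stages, no matter where the window begins. The freedom in the position of the
window lets Player 2 wait until Player 1 has stopped gambling.

Let Player 2 play \<open>L\<close> with a small probability \<open>\<eta>\<close> at every stage, independently of the past. In the
state \<open>Omega\<close> Player 1 plays \<open>T\<close> at most once, because this absorbs the game
(\<open>big_match_T_at_most_once\<close>); so the probabilities of absorption at the individual stages have a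
sum of at most 1, and only the share \<open>\<eta>\<close> of it is absorption with payoff 1
(\<open>win_fraction_of_stationary_mix\<close>). The series converges, hence after some stage \<open>m\<close> the total
probability of absorption within \<open>N\<close> stages is as small as desired, in particular small compared
with \<open>\<eta> ^ N\<close>.

Now let Player 2 play the mixture up to stage \<open>m\<close> and \<open>L\<close> afterwards. The mixture itself plays \<open>N\<close> times
\<open>L\<close> with probability \<open>\<eta> ^ N\<close>, so the new strategy enlarges probabilities of events up to stage
\<open>m + N\<close> by a factor of at most \<open>1 / \<eta> ^ N\<close> (\<open>pmf_triple_law_dominated\<close>), and absorption in the window
stays unlikely. Against \<open>L\<close>, Player 1 receives something in the window only if he has been
absorbed with payoff 1, before \<open>m\<close> or in the window (\<open>big_match_average_le_wins\<close>). Both have small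
probability, so the average over the window is small (\<open>big_match_late_average_small\<close>), against the
choice of \<open>\<sigma>\<close>.

All events involved depend on finitely many stages; \<open>distr_play_prefix\<close> identifies their law under
the infinite-play measure with a recursively defined law on lists.
\<close>

section \<open>Laws of finite initial segments of a play\<close>

context stochastic_game
begin

definition next_stage_law ::
  "'k \<Rightarrow> ('k, 'i, 'j, 'i) strategy \<Rightarrow> ('k, 'i, 'j, 'j) strategy
    \<Rightarrow> ('k \<times> 'i \<times> 'j) list \<Rightarrow> ('k \<times> 'i \<times> 'j) pmf" where
  "next_stage_law k1 \<sigma> \<tau> l = stage_law k1 \<sigma> \<tau> (length l) (\<lambda>i. l ! i)"

primrec prefix_law ::
  "'k \<Rightarrow> ('k, 'i, 'j, 'i) strategy \<Rightarrow> ('k, 'i, 'j, 'j) strategy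
    \<Rightarrow> nat \<Rightarrow> ('k \<times> 'i \<times> 'j) list pmf" where
  "prefix_law k1 \<sigma> \<tau> 0 = return_pmf []"
| "prefix_law k1 \<sigma> \<tau> (Suc n) =
     bind_pmf (prefix_law k1 \<sigma> \<tau> n) (\<lambda>l. map_pmf (\<lambda>z. l @ [z]) (next_stage_law k1 \<sigma> \<tau> l))"

lemma stage_law_eq_next_stage_law:
  "stage_law k1 \<sigma> \<tau> n x = next_stage_law k1 \<sigma> \<tau> (map x [0..<n])"
proof -
  have "map ((!) (map x [0..<n])) [0..<n] = map x [0..<n]"
    using map_nth[of "map x [0..<n]"] by simp
  moreover have "state_law k1 n (\<lambda>i. map x [0..<n] ! i) = state_law k1 n x"
    by (simp add: state_law_def)
  ultimately show ?thesis
    unfolding next_stage_law_def stage_law_def by (simp del: map_eq_conv)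
qed

text \<open>
The finite-dimensional kernels of the Ionescu-Tulcea construction live on functions with domain
\<open>{0..<n}\<close>, the prefix law on lists; appending one triple is a function update on the one side and
a snoc on the other, so the two recursions agree.
\<close>

lemma nn_integral_finite_stages:
  fixes f :: "('k \<times> 'i \<times> 'j) list \<Rightarrow> ennreal"
  shows "(\<integral>\<^sup>+x. f (map x [0..<n]) \<partial>Ionescu_Tulcea.C (\<lambda>n x. measure_pmf (stage_law k1 \<sigma> \<tau> n x))
             (\<lambda>_. count_space UNIV) 0 n (\<lambda>_. undefined))
       = (\<integral>\<^sup>+l. f l \<partial>prefix_law k1 \<sigma> \<tau> n)"
proof (induction n arbitrary: f)
  interpret Ionescu_Tulcea "\<lambda>n x. measure_pmf (stage_law k1 \<sigma> \<tau> n x)" "\<lambda>_. count_space UNIV"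
    by (rule Ionescu_Tulcea_stage_law)
  have discrete: "PiM {0..<n} (\<lambda>_. count_space (UNIV :: ('k \<times> 'i \<times> 'j) set)) =
      count_space (PiE {0..<n} (\<lambda>_. UNIV))" for n :: nat
    by (intro count_space_PiM_finite) auto
  have u: "(\<lambda>_. undefined) \<in> space (PiM {0..<0 :: nat} (\<lambda>_. count_space UNIV))"
    by (simp add: space_PiM)
  { case 0
    show ?case
      by (simp add: nn_integral_return PiM_empty)
  next
    case (Suc n)
    have spaceC: "space (C 0 n (\<lambda>_. undefined)) = space (PiM {0..<n} (\<lambda>_. count_space UNIV))"
      using space_C[OF u, of n] by simp
    have "(\<integral>\<^sup>+x. f (map x [0..<Suc n]) \<partial>C 0 (Suc n) (\<lambda>_. undefined))
        = (\<integral>\<^sup>+x. \<integral>\<^sup>+y. f (map y [0..<Suc n]) \<partial>eP n x \<partial>C 0 n (\<lambda>_. undefined))"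
      using measurable_eP[of n] u
      by (subst C.simps, subst nn_integral_bind[where B="PiM {0..<Suc n} (\<lambda>_. count_space UNIV)"])
         (simp_all add: discrete measurable_cong_sets[OF sets_C[OF u]])
    also have "\<dots> = (\<integral>\<^sup>+x. (\<lambda>l. \<integral>\<^sup>+z. f (l @ [z]) \<partial>next_stage_law k1 \<sigma> \<tau> l) (map x [0..<n])
                       \<partial>C 0 n (\<lambda>_. undefined))"
    proof (rule nn_integral_cong)
      fix x assume "x \<in> space (C 0 n (\<lambda>_. undefined))"
      then have x: "x \<in> space (PiM {0..<n} (\<lambda>_. count_space UNIV))"
        by (simp add: spaceC)
      have "(\<integral>\<^sup>+y. f (map y [0..<Suc n]) \<partial>eP n x)
          = (\<integral>\<^sup>+z. f (map (x(n := z)) [0..<Suc n]) \<partial>stage_law k1 \<sigma> \<tau> n x)"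
        by (rule nn_integral_eP[OF x]) (simp add: discrete)
      moreover have "map (x(n := z)) [0..<Suc n] = map x [0..<n] @ [z]" for z
        by simp
      ultimately show "(\<integral>\<^sup>+y. f (map y [0..<Suc n]) \<partial>eP n x)
          = (\<lambda>l. \<integral>\<^sup>+z. f (l @ [z]) \<partial>next_stage_law k1 \<sigma> \<tau> l) (map x [0..<n])"
        by (simp add: stage_law_eq_next_stage_law)
    qed
    also have "\<dots> = (\<integral>\<^sup>+l. f l \<partial>prefix_law k1 \<sigma> \<tau> (Suc n))"
      by (subst Suc.IH) simp
    finally show ?case .
  }
qed

text \<open>
This turns expectations over infinite plays of quantities that depend on finitely many stages into
finite sums, which is all that is needed for average payoffs.
\<close>

lemma distr_play_prefix:
  "distr (play_measure k1 \<sigma> \<tau>) (count_space UNIV) (\<lambda>x. map x [0..<n])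
     = measure_pmf (prefix_law k1 \<sigma> \<tau> n)"
proof -
  interpret Ionescu_Tulcea "\<lambda>n x. measure_pmf (stage_law k1 \<sigma> \<tau> n x)" "\<lambda>_. count_space UNIV"
    by (rule Ionescu_Tulcea_stage_law)
  let ?M = "\<lambda>J. PiM J (\<lambda>_. count_space (UNIV :: ('k \<times> 'i \<times> 'j) set))"
  have discrete: "?M {0..<n} = count_space (PiE {0..<n} (\<lambda>_. UNIV))"
    by (intro count_space_PiM_finite) auto
  have u: "(\<lambda>_. undefined) \<in> space (?M {0..<0 :: nat})"
    by (simp add: space_PiM)
  have up_to: "up_to {0..<n} = n"
  proof (rule antisym)
    show "up_to {0..<n} \<le> n"
      by (simp add: up_to_iff)
    show "n \<le> up_to {0..<n}"
      using up_to[of "{0..<n}"] by auto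
  qed
  have prefix[measurable]: "(\<lambda>x. map x [0..<n]) \<in> measurable (?M {0..<n}) (count_space UNIV)"
    by (simp add: discrete)
  have restrict_play[measurable]:
    "(\<lambda>x. restrict x {0..<n}) \<in> measurable (play_measure k1 \<sigma> \<tau>) (?M {0..<n})"
    by (subst measurable_cong_sets[OF sets_play_measure refl]) (rule measurable_restrict_subset, simp)
  have restrict_C[measurable]:
    "(\<lambda>x. restrict x {0..<n}) \<in> measurable (C 0 n (\<lambda>_. undefined)) (?M {0..<n})"
    using sets_C[OF u, of n]
    by (subst measurable_cong_sets[OF _ refl, where M'="?M {0..<n}"]) (auto intro: measurable_restrict_subset)
  \<comment> \<open>The finite-dimensional marginals of the limit measure are laws of restrictions; a prefix survives restriction.\<close>
  have map_restrict: "map (restrict x {0..<n}) [0..<n] = map x [0..<n]" for x :: "('k, 'i, 'j) play"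
    by simp
  have "distr (play_measure k1 \<sigma> \<tau>) (count_space UNIV) (\<lambda>x. map x [0..<n])
      = distr (distr (play_measure k1 \<sigma> \<tau>) (?M {0..<n}) (\<lambda>x. restrict x {0..<n}))
          (count_space UNIV) (\<lambda>x. map x [0..<n])"
    by (subst distr_distr) (auto simp: comp_def map_restrict intro: prefix restrict_play)
  also have "distr (play_measure k1 \<sigma> \<tau>) (?M {0..<n}) (\<lambda>x. restrict x {0..<n}) = CI {0..<n}"
    unfolding play_measure_def by (rule distr_lim) simp
  also have "\<dots> = distr (C 0 n (\<lambda>_. undefined)) (?M {0..<n}) (\<lambda>x. restrict x {0..<n})"
    by (simp add: CI_def up_to)
  also have "distr \<dots> (count_space UNIV) (\<lambda>x. map x [0..<n])
      = distr (C 0 n (\<lambda>_. undefined)) (count_space UNIV) (\<lambda>x. map x [0..<n])"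
    by (subst distr_distr) (auto simp: comp_def map_restrict intro: prefix restrict_C)
  also have "\<dots> = measure_pmf (prefix_law k1 \<sigma> \<tau> n)"
  proof (rule measure_eqI)
    fix A :: "('k \<times> 'i \<times> 'j) list set"
    have m: "(\<lambda>x. map x [0..<n]) \<in> measurable (C 0 n (\<lambda>_. undefined)) (count_space UNIV)"
      using sets_C[OF u, of n] prefix
      by (subst measurable_cong_sets[OF _ refl, where M'="?M {0..<n}"]) simp_all
    have "emeasure (distr (C 0 n (\<lambda>_. undefined)) (count_space UNIV) (\<lambda>x. map x [0..<n])) A
        = (\<integral>\<^sup>+x. indicator A (map x [0..<n]) \<partial>C 0 n (\<lambda>_. undefined))"
      using m by (subst nn_integral_indicator[symmetric], simp) (subst nn_integral_distr, auto)
    also have "\<dots> = emeasure (prefix_law k1 \<sigma> \<tau> n) A"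
      by (subst nn_integral_finite_stages) simp
    finally show "emeasure (distr (C 0 n (\<lambda>_. undefined)) (count_space UNIV) (\<lambda>x. map x [0..<n])) A
        = emeasure (prefix_law k1 \<sigma> \<tau> n) A" .
  qed simp
  finally show ?thesis .
qed

lemma integral_play_prefix:
  fixes f :: "('k \<times> 'i \<times> 'j) list \<Rightarrow> real"
  shows "(LINT x | play_measure k1 \<sigma> \<tau>. f (map x [0..<n]))
       = measure_pmf.expectation (prefix_law k1 \<sigma> \<tau> n) f"
proof -
  have "(\<lambda>x. map x [0..<n]) \<in> measurable (play_measure k1 \<sigma> \<tau>) (count_space UNIV)"
  proof -
    have "(\<lambda>x. map x [0..<n]) \<in> measurable (PiM {0..<n} (\<lambda>_. count_space (UNIV :: ('k \<times> 'i \<times> 'j) set))) (count_space UNIV)"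
      by (subst count_space_PiM_finite) auto
    moreover have "(\<lambda>x. restrict x {0..<n}) \<in> measurable (play_measure k1 \<sigma> \<tau>)
        (PiM {0..<n} (\<lambda>_. count_space UNIV))"
      by (subst measurable_cong_sets[OF sets_play_measure refl]) (rule measurable_restrict_subset, simp)
    ultimately have "(\<lambda>x. map (restrict x {0..<n}) [0..<n]) \<in> measurable (play_measure k1 \<sigma> \<tau>) (count_space UNIV)"
      by (rule measurable_compose[rotated])
    moreover have "map (restrict x {0..<n}) [0..<n] = map x [0..<n]" for x :: "('k, 'i, 'j) play"
      by simp
    ultimately show ?thesis by (simp only:)
  qed
  then show ?thesis
    by (simp add: integral_distr flip: distr_play_prefix)
qed

lemma set_prefix_law:
  assumes "l \<in> set_pmf (prefix_law k1 \<sigma> \<tau> n)"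
  shows "length l = n"
    and "Suc s < n \<Longrightarrow> fst (l ! Suc s) \<in> set_pmf (q (l ! s))"
    and "0 < n \<Longrightarrow> fst (l ! 0) = k1"
proof -
  have "length l = n \<and> (\<forall>s. Suc s < n \<longrightarrow> fst (l ! Suc s) \<in> set_pmf (q (l ! s))) \<and>
      (0 < n \<longrightarrow> fst (l ! 0) = k1)"
    using assms
  proof (induction n arbitrary: l)
    case (Suc n)
    then obtain l' z where l': "l' \<in> set_pmf (prefix_law k1 \<sigma> \<tau> n)"
      and z: "z \<in> set_pmf (next_stage_law k1 \<sigma> \<tau> l')" and l: "l = l' @ [z]"
      by auto
    from z have "fst z \<in> set_pmf (state_law k1 (length l') (\<lambda>i. l' ! i))"
      by (auto simp: next_stage_law_def stage_law_def Let_def)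
    with Suc.IH[OF l'] show ?case
      by (cases n) (auto simp: l nth_append state_law_def less_Suc_eq)
  qed simp
  then show "length l = n"
    and "Suc s < n \<Longrightarrow> fst (l ! Suc s) \<in> set_pmf (q (l ! s))"
    and "0 < n \<Longrightarrow> fst (l ! 0) = k1"
    by auto
qed

lemma pmf_next_stage_law:
  "pmf (next_stage_law k1 \<sigma> \<tau> l) (k, i, j) =
     pmf (state_law k1 (length l) (\<lambda>i. l ! i)) k * pmf (\<sigma> (l, k)) i * pmf (\<tau> (l, k)) j"
proof -
  let ?S = "state_law k1 (length l) (\<lambda>i. l ! i)"
  have *: "pmf (map_pmf (Pair k') (pair_pmf (\<sigma> (l, k')) (\<tau> (l, k')))) (k, i, j)
     = indicator {k} k' * (pmf (\<sigma> (l, k)) i * pmf (\<tau> (l, k)) j)" for k'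
  proof (cases "k' = k")
    case True
    have inj: "inj (Pair k :: 'i \<times> 'j \<Rightarrow> _)"
      by (auto simp: inj_def)
    show ?thesis
      using pmf_map_inj'[OF inj, of "pair_pmf (\<sigma> (l, k)) (\<tau> (l, k))" "(i, j)"] True
      by (simp add: pmf_pair)
  next
    case False
    then show ?thesis
      by (subst pmf_map_outside) auto
  qed
  have "pmf (next_stage_law k1 \<sigma> \<tau> l) (k, i, j)
      = (\<integral>k'. indicator {k} k' * (pmf (\<sigma> (l, k)) i * pmf (\<tau> (l, k)) j) \<partial>?S)"
    by (simp add: next_stage_law_def stage_law_def pmf_bind Let_def map_nth *)
  then show ?thesis
    by (simp add: measure_pmf_single)
qed

lemma pmf_prefix_law_snoc:
  "pmf (prefix_law k1 \<sigma> \<tau> (Suc n)) (l @ [z]) =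
     pmf (prefix_law k1 \<sigma> \<tau> n) l * pmf (next_stage_law k1 \<sigma> \<tau> l) z"
proof -
  have *: "pmf (map_pmf (\<lambda>z. l' @ [z]) (next_stage_law k1 \<sigma> \<tau> l')) (l @ [z])
      = indicator {l} l' * pmf (next_stage_law k1 \<sigma> \<tau> l) z" for l'
  proof (cases "l' = l")
    case True
    have inj: "inj (\<lambda>z. l @ [z])"
      by (auto simp: inj_def)
    show ?thesis
      using pmf_map_inj'[OF inj] True by simp
  next
    case False
    then show ?thesis
      by (subst pmf_map_outside) auto
  qed
  show ?thesis
    by (simp add: pmf_bind * measure_pmf_single)
qed

text \<open>
The probability of a finite play is a product of one factor per stage, and Player 2 enters only
through the probabilities of his own actions. Bounding his action probabilities stage by stage
therefore bounds the probability of every finite play, whatever Player 1 does.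
\<close>

lemma pmf_prefix_law_dominated:
  assumes c: "\<And>t. t < n \<Longrightarrow> 0 \<le> c t"
    and dom: "\<And>l k j. length l < n \<Longrightarrow> c (length l) * pmf (\<tau>' (l, k)) j \<le> pmf (\<tau> (l, k)) j"
  shows "(\<Prod>t<n. c t) * pmf (prefix_law k1 \<sigma> \<tau>' n) l \<le> pmf (prefix_law k1 \<sigma> \<tau> n) l"
  using assms
proof (induction n arbitrary: l)
  case (Suc n)
  consider "length l \<noteq> Suc n" | l' z where "l = l' @ [z]" "length l' = n"
    by (metis length_Suc_conv_rev)
  then show ?case
  proof cases
    case 1
    then have "pmf (prefix_law k1 \<sigma> \<tau>' (Suc n)) l = 0"
      using set_prefix_law(1) by (metis set_pmf_iff)
    then show ?thesis by simp
  next
    case 2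
    obtain k i j where z: "z = (k, i, j)" by (cases z)
    have prefix: "(\<Prod>t<n. c t) * pmf (prefix_law k1 \<sigma> \<tau>' n) l' \<le> pmf (prefix_law k1 \<sigma> \<tau> n) l'"
      using Suc by simp
    have "pmf (state_law k1 (length l') (\<lambda>i. l' ! i)) k * pmf (\<sigma> (l', k)) i
              * (c n * pmf (\<tau>' (l', k)) j)
        \<le> pmf (state_law k1 (length l') (\<lambda>i. l' ! i)) k * pmf (\<sigma> (l', k)) i * pmf (\<tau> (l', k)) j"
      using Suc.prems(2)[of l' k j] 2 by (intro mult_left_mono) auto
    then have "c n * pmf (next_stage_law k1 \<sigma> \<tau>' l') z \<le> pmf (next_stage_law k1 \<sigma> \<tau> l') z"
      by (simp add: z pmf_next_stage_law mult_ac)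
    with prefix have "((\<Prod>t<n. c t) * pmf (prefix_law k1 \<sigma> \<tau>' n) l')
          * (c n * pmf (next_stage_law k1 \<sigma> \<tau>' l') z)
        \<le> pmf (prefix_law k1 \<sigma> \<tau> n) l' * pmf (next_stage_law k1 \<sigma> \<tau> l') z"
      using Suc.prems(1)[of n] by (intro mult_mono) auto
    then show ?thesis
      by (simp add: 2 pmf_prefix_law_snoc mult_ac del: prefix_law.simps)
  qed
qed simp

lemma prob_prefix_law_dominated:
  assumes c: "\<And>t. t < n \<Longrightarrow> 0 \<le> c t"
    and dom: "\<And>l k j. length l < n \<Longrightarrow> c (length l) * pmf (\<tau>' (l, k)) j \<le> pmf (\<tau> (l, k)) j"
  shows "(\<Prod>t<n. c t) * measure (prefix_law k1 \<sigma> \<tau>' n) A \<le> measure (prefix_law k1 \<sigma> \<tau> n) A"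
proof -
  let ?p = "prefix_law k1 \<sigma> \<tau>' n" and ?q = "prefix_law k1 \<sigma> \<tau> n" and ?A = "A \<inter> {l. length l = n}"
  have fin: "finite ?A"
    using finite_lists_length_eq[of "UNIV :: ('k \<times> 'i \<times> 'j) set" n] by auto
  have eq: "measure (prefix_law k1 \<sigma> \<tau> n) A = (\<Sum>l\<in>?A. pmf (prefix_law k1 \<sigma> \<tau> n) l)" for \<tau>
  proof -
    have "measure (prefix_law k1 \<sigma> \<tau> n) A = measure (prefix_law k1 \<sigma> \<tau> n) ?A"
      by (rule measure_prob_cong_0) (auto simp: pmf_eq_0_set_pmf dest: set_prefix_law(1))
    then show ?thesis
      by (simp add: measure_measure_pmf_finite[OF fin])
  qed
  show ?thesis
    unfolding eq sum_distrib_left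
    by (intro sum_mono pmf_prefix_law_dominated assms)
qed

section \<open>The law of a single stage\<close>

definition triple_law ::
  "'k \<Rightarrow> ('k, 'i, 'j, 'i) strategy \<Rightarrow> ('k, 'i, 'j, 'j) strategy
    \<Rightarrow> nat \<Rightarrow> ('k \<times> 'i \<times> 'j) pmf" where
  "triple_law k1 \<sigma> \<tau> s = bind_pmf (prefix_law k1 \<sigma> \<tau> s) (next_stage_law k1 \<sigma> \<tau>)"

lemma map_pmf_last_prefix_law:
  "map_pmf last (prefix_law k1 \<sigma> \<tau> (Suc s)) = triple_law k1 \<sigma> \<tau> s"
  by (simp add: triple_law_def map_bind_pmf pmf.map_comp comp_def)

lemma map_pmf_nth_prefix_law:
  assumes "s < n"
  shows "map_pmf (\<lambda>l. l ! s) (prefix_law k1 \<sigma> \<tau> n) = triple_law k1 \<sigma> \<tau> s"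
proof -
  from assms have "Suc s \<le> n" by simp
  then show ?thesis
  proof (induction n rule: dec_induct)
    case base
    have "map_pmf (\<lambda>l. l ! s) (prefix_law k1 \<sigma> \<tau> (Suc s)) = map_pmf last (prefix_law k1 \<sigma> \<tau> (Suc s))"
    proof (rule map_pmf_cong[OF refl])
      fix l assume "l \<in> set_pmf (prefix_law k1 \<sigma> \<tau> (Suc s))"
      then have "length l = Suc s" by (rule set_prefix_law(1))
      then show "l ! s = last l" by (metis diff_Suc_1 last_conv_nth length_0_conv nat.simps(3))
    qed
    then show ?case
      by (simp only: map_pmf_last_prefix_law)
  next
    case (step n)
    have "map_pmf (\<lambda>l. l ! s) (prefix_law k1 \<sigma> \<tau> (Suc n))
        = bind_pmf (prefix_law k1 \<sigma> \<tau> n) (\<lambda>l. map_pmf (\<lambda>z. (l @ [z]) ! s) (next_stage_law k1 \<sigma> \<tau> l))"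
      by (simp add: map_bind_pmf pmf.map_comp comp_def)
    also have "\<dots> = bind_pmf (prefix_law k1 \<sigma> \<tau> n) (\<lambda>l. return_pmf (l ! s))"
    proof (rule bind_pmf_cong[OF refl])
      fix l assume "l \<in> set_pmf (prefix_law k1 \<sigma> \<tau> n)"
      then have "length l = n" by (rule set_prefix_law(1))
      with step.hyps show "map_pmf (\<lambda>z. (l @ [z]) ! s) (next_stage_law k1 \<sigma> \<tau> l) = return_pmf (l ! s)"
        by (simp add: nth_append map_pmf_const)
    qed
    also have "\<dots> = map_pmf (\<lambda>l. l ! s) (prefix_law k1 \<sigma> \<tau> n)"
      by (simp add: map_pmf_def)
    finally show ?case
      using step.IH by simp
  qed
qed

lemma pmf_triple_law_dominated:
  assumes c: "\<And>t. t \<le> s \<Longrightarrow> 0 \<le> c t"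
    and dom: "\<And>l k j. length l \<le> s \<Longrightarrow> c (length l) * pmf (\<tau>' (l, k)) j \<le> pmf (\<tau> (l, k)) j"
  shows "(\<Prod>t\<le>s. c t) * pmf (triple_law k1 \<sigma> \<tau>' s) z \<le> pmf (triple_law k1 \<sigma> \<tau> s) z"
  using prob_prefix_law_dominated[of "Suc s" c \<tau>' \<tau> k1 \<sigma> "last -` {z}"] assms
  by (simp add: pmf_map lessThan_Suc_atMost less_Suc_eq_le del: prefix_law.simps
       flip: map_pmf_last_prefix_law)

lemma finite_set_prefix_law: "finite (set_pmf (prefix_law k1 \<sigma> \<tau> n))"
  by (induction n) auto

lemma expectation_sum_over_stages:
  fixes f :: "'k \<times> 'i \<times> 'j \<Rightarrow> real"
  shows "measure_pmf.expectation (prefix_law k1 \<sigma> \<tau> n) (\<lambda>l. \<Sum>s<n. f (l ! s))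
       = (\<Sum>s<n. measure_pmf.expectation (triple_law k1 \<sigma> \<tau> s) f)"
proof -
  have "measure_pmf.expectation (prefix_law k1 \<sigma> \<tau> n) (\<lambda>l. \<Sum>s<n. f (l ! s))
      = (\<Sum>s<n. measure_pmf.expectation (prefix_law k1 \<sigma> \<tau> n) (\<lambda>l. f (l ! s)))"
    by (intro Bochner_Integration.integral_sum integrable_measure_pmf_finite finite_set_prefix_law)
  also have "\<dots> = (\<Sum>s<n. measure_pmf.expectation (triple_law k1 \<sigma> \<tau> s) f)"
    by (intro sum.cong refl) (simp flip: map_pmf_nth_prefix_law)
  finally show ?thesis .
qed

text \<open>
If the probability with which Player 2 takes an action at a stage does not depend on the past, it
factors out, and what remains does not mention that action. So two such actions occur together
with a given state and action of Player 1 in the ratio of their probabilities.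
\<close>

lemma pmf_triple_law_const:
  assumes "\<And>l. length l = s \<Longrightarrow> pmf (\<tau> (l, k)) j = c"
  shows "pmf (triple_law k1 \<sigma> \<tau> s) (k, i, j) =
    c * measure_pmf.expectation (prefix_law k1 \<sigma> \<tau> s)
          (\<lambda>l. pmf (state_law k1 (length l) (\<lambda>i. l ! i)) k * pmf (\<sigma> (l, k)) i)"
proof -
  have "pmf (triple_law k1 \<sigma> \<tau> s) (k, i, j) = measure_pmf.expectation (prefix_law k1 \<sigma> \<tau> s)
          (\<lambda>l. c * (pmf (state_law k1 (length l) (\<lambda>i. l ! i)) k * pmf (\<sigma> (l, k)) i))"
    unfolding triple_law_def pmf_bind pmf_next_stage_law
    by (intro integral_cong_AE) (auto simp: AE_measure_pmf_iff assms dest!: set_prefix_law(1))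
  then show ?thesis by simp
qed

end

section \<open>Absorption in the Big Match\<close>

lemma set_bm_transition [simp]: "set_pmf (bm_transition z) = {bm_next z}"
  by (simp add: bm_transition_def)

lemma big_match_absorbed_after_T:
  assumes l: "l \<in> set_pmf (big_match.prefix_law Omega \<sigma> \<tau> n)"
    and "l ! s = (Omega, T, j)" "s < t" "t < n"
  shows "fst (l ! t) \<noteq> Omega"
proof -
  from \<open>s < t\<close> have "Suc s \<le> t" by simp
  then show ?thesis using \<open>t < n\<close>
  proof (induction t rule: dec_induct)
    case base
    then show ?case
      using big_match.set_prefix_law(2)[OF l, of s] assms(2) by (cases j) auto
  next
    case (step t)
    then show ?case
      using big_match.set_prefix_law(2)[OF l, of t] by (cases "l ! t" rule: bm_next.cases) auto
  qed
qed

lemma big_match_Absorb1_only_by_TL: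
  assumes l: "l \<in> set_pmf (big_match.prefix_law Omega \<sigma> \<tau> n)"
    and "t < n" "fst (l ! t) = Absorb1"
  shows "\<exists>s<t. l ! s = (Omega, T, L)"
  using assms(2,3)
proof (induction t)
  case 0
  then show ?case
    using big_match.set_prefix_law(3)[OF l] by simp
next
  case (Suc t)
  then have "bm_next (l ! t) = Absorb1"
    using big_match.set_prefix_law(2)[OF l, of t] by simp
  then have "fst (l ! t) = Absorb1 \<or> l ! t = (Omega, T, L)"
    by (cases "l ! t" rule: bm_next.cases) auto
  then show ?case
    using Suc by (auto simp: less_Suc_eq)
qed

text \<open>
A play that starts in \<open>Omega\<close> enters \<open>Absorb1\<close> only through \<open>(T, L)\<close>, a win of Player 1. So a win, now
or earlier, is the only source of payoff besides \<open>(B, R)\<close>, and counting wins bounds the payoff.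
\<close>

lemma big_match_payoff_le_wins:
  assumes l: "l \<in> set_pmf (big_match.prefix_law Omega \<sigma> \<tau> n)"
    and t: "t < n" "l ! t \<noteq> (Omega, B, R)"
  shows "bm_payoff (l ! t) \<le> (\<Sum>s<n. indicator {(Omega, T, L)} (l ! s))"
proof -
  let ?wins = "\<Sum>s<n. indicator {(Omega, T, L)} (l ! s) :: real"
  have win: "1 \<le> ?wins" if "s < n" "l ! s = (Omega, T, L)" for s
    using member_le_sum[of s "{..<n}" "\<lambda>s. indicator {(Omega, T, L)} (l ! s) :: real"] that by simp
  have "0 \<le> ?wins"
    by (intro sum_nonneg) simp
  show ?thesis
  proof (cases "l ! t" rule: bm_payoff.cases)
    case 1
    with win[of t] t show ?thesis by simp
  next
    case (5 i j)
    then obtain s where "s < t" "l ! s = (Omega, T, L)"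
      using big_match_Absorb1_only_by_TL[OF l t(1)] by auto
    with win[of s] t 5 show ?thesis by simp
  qed (use t(2) \<open>0 \<le> ?wins\<close> in auto)
qed

lemma big_match_T_at_most_once:
  "(\<Sum>s<n. measure (big_match.triple_law Omega \<sigma> \<tau> s) {(Omega, T, L), (Omega, T, R)}) \<le> 1"
proof -
  let ?D = "{(Omega, T, L), (Omega, T, R)}"
  have once: "(\<Sum>s<n. indicator ?D (l ! s) :: real) \<le> 1"
    if l: "l \<in> set_pmf (big_match.prefix_law Omega \<sigma> \<tau> n)" for l
  proof -
    have "(\<Sum>s<n. indicator ?D (l ! s) :: real) = real (card {s \<in> {..<n}. l ! s \<in> ?D})"
      using sum_mult_indicator[of "{..<n}" "\<lambda>_. 1 :: real" "\<lambda>_. ?D" "\<lambda>s. l ! s"]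
      by (simp del: insert_iff singleton_iff)
    also have "card {s \<in> {..<n}. l ! s \<in> ?D} \<le> 1"
    proof -
      have "s = t" if "s < n" "t < n" "l ! s \<in> ?D" "l ! t \<in> ?D" for s t
        using that big_match_absorbed_after_T[OF l, of s _ t] big_match_absorbed_after_T[OF l, of t _ s]
        by (cases s t rule: linorder_cases) auto
      then show ?thesis
        by (auto simp: card_le_Suc0_iff_eq)
    qed
    finally show ?thesis by simp
  qed
  have "(\<Sum>s<n. measure (big_match.triple_law Omega \<sigma> \<tau> s) ?D)
      = (\<Sum>s<n. measure_pmf.expectation (big_match.triple_law Omega \<sigma> \<tau> s) (indicator ?D))"
    by simp
  also have "\<dots> = measure_pmf.expectation (big_match.prefix_law Omega \<sigma> \<tau> n)
                    (\<lambda>l. \<Sum>s<n. indicator ?D (l ! s))"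
    by (rule big_match.expectation_sum_over_stages[symmetric])
  also have "\<dots> \<le> measure_pmf.expectation (big_match.prefix_law Omega \<sigma> \<tau> n) (\<lambda>_. 1)"
    by (intro integral_mono_AE integrable_measure_pmf_finite big_match.finite_set_prefix_law)
       (use once in \<open>simp add: AE_measure_pmf_iff\<close>)
  finally show ?thesis by simp
qed

section \<open>Exhausting Player 1 with a stationary mixture\<close>

definition mix_LR :: "real \<Rightarrow> bm_action2 pmf" where
  "mix_LR \<eta> = map_pmf (\<lambda>b. if b then L else R) (bernoulli_pmf \<eta>)"

lemma pmf_mix_LR:
  assumes "0 \<le> \<eta>" "\<eta> \<le> 1"
  shows "pmf (mix_LR \<eta>) L = \<eta>" "pmf (mix_LR \<eta>) R = 1 - \<eta>"
proof -
  have inj: "inj (\<lambda>b. if b then L else R)"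
    by (auto simp: inj_def split: if_splits)
  show "pmf (mix_LR \<eta>) L = \<eta>" "pmf (mix_LR \<eta>) R = 1 - \<eta>"
    using pmf_map_inj'[OF inj, of "bernoulli_pmf \<eta>" True]
      pmf_map_inj'[OF inj, of "bernoulli_pmf \<eta>" False] assms
    by (simp_all add: mix_LR_def)
qed

text \<open>
Player 1 chooses \<open>T\<close> without seeing the simultaneous action of Player 2, so a share \<open>\<eta>\<close> of the
absorptions are wins for him.
\<close>

lemma win_fraction_of_stationary_mix:
  assumes "0 \<le> \<eta>" "\<eta> \<le> 1"
  shows "pmf (big_match.triple_law Omega \<sigma> (\<lambda>_. mix_LR \<eta>) s) (Omega, T, L)
       = \<eta> * measure (big_match.triple_law Omega \<sigma> (\<lambda>_. mix_LR \<eta>) s) {(Omega, T, L), (Omega, T, R)}"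
proof -
  let ?p = "big_match.triple_law Omega \<sigma> (\<lambda>_. mix_LR \<eta>) s"
  obtain e where e: "pmf ?p (Omega, T, L) = \<eta> * e" "pmf ?p (Omega, T, R) = (1 - \<eta>) * e"
    using big_match.pmf_triple_law_const[of s "\<lambda>_. mix_LR \<eta>" Omega L \<eta> Omega \<sigma> T]
      big_match.pmf_triple_law_const[of s "\<lambda>_. mix_LR \<eta>" Omega R "1 - \<eta>" Omega \<sigma> T]
      pmf_mix_LR[OF assms] that by blast
  have "measure ?p {(Omega, T, L), (Omega, T, R)} = e"
    by (simp add: measure_measure_pmf_finite e algebra_simps)
  with e show ?thesis by simp
qed

lemma big_match_average_le_wins:
  assumes n: "0 < n" and L: "\<And>h. m \<le> length (fst h) \<Longrightarrow> \<tau> h = return_pmf L"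
  shows "(LINT x | big_match.play_measure Omega \<sigma> \<tau>.
            1 / real n * (\<Sum>i = m + 1..m + n. big_match.stage_payoff i x))
       \<le> (\<Sum>s<m + n. pmf (big_match.triple_law Omega \<sigma> \<tau> s) (Omega, T, L))"
proof -
  let ?P = "big_match.prefix_law Omega \<sigma> \<tau> (m + n)"
  let ?F = "\<lambda>l. 1 / real n * (\<Sum>i = m + 1..m + n. bm_payoff (l ! (i - 1)))"
  let ?wins = "\<lambda>l. \<Sum>s<m + n. indicator {(Omega, T, L)} (l ! s) :: real"
  have "?F l \<le> ?wins l" if l: "l \<in> set_pmf ?P" for l
  proof -
    have "bm_payoff (l ! (i - 1)) \<le> ?wins l" if i: "i \<in> {m + 1..m + n}" for i
    proof (rule big_match_payoff_le_wins[OF l])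
      show "i - 1 < m + n" using i by auto
      \<comment> \<open>In the window Player 2 plays L, so the only way to a payoff without a win, (B, R), has probability zero.\<close>
      have "l ! (i - 1) \<in> set_pmf (map_pmf (\<lambda>l. l ! (i - 1)) ?P)"
        using l by auto
      then have "pmf (big_match.triple_law Omega \<sigma> \<tau> (i - 1)) (l ! (i - 1)) \<noteq> 0"
        unfolding big_match.map_pmf_nth_prefix_law[OF \<open>i - 1 < m + n\<close>] set_pmf_iff .
      moreover have "pmf (big_match.triple_law Omega \<sigma> \<tau> (i - 1)) (Omega, B, R) = 0"
        using i by (subst big_match.pmf_triple_law_const[where c=0]) (auto simp: L)
      ultimately show "l ! (i - 1) \<noteq> (Omega, B, R)" by metis
    qed
    then have "(\<Sum>i = m + 1..m + n. bm_payoff (l ! (i - 1))) \<le> real (card {m + 1..m + n}) * ?wins l"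
      by (rule sum_bounded_above)
    then show ?thesis
      using n by (simp add: field_simps)
  qed
  then have "measure_pmf.expectation ?P ?F \<le> measure_pmf.expectation ?P ?wins"
    by (intro integral_mono_AE integrable_measure_pmf_finite big_match.finite_set_prefix_law)
       (simp add: AE_measure_pmf_iff)
  also have "\<dots> = (\<Sum>s<m + n. pmf (big_match.triple_law Omega \<sigma> \<tau> s) (Omega, T, L))"
    by (subst big_match.expectation_sum_over_stages) (simp add: measure_pmf_single)
  also have "measure_pmf.expectation ?P ?F = (LINT x | big_match.play_measure Omega \<sigma> \<tau>.
            1 / real n * (\<Sum>i = m + 1..m + n. big_match.stage_payoff i x))"
  proof -
    have "?F (map x [0..<m + n]) = 1 / real n * (\<Sum>i = m + 1..m + n. big_match.stage_payoff i x)" for x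
      unfolding big_match.stage_payoff_def by (intro arg_cong2[where f="(*)"] sum.cong refl) auto
    then show ?thesis
      using big_match.integral_play_prefix[of Omega \<sigma> \<tau> ?F "m + n"] by (simp only:)
  qed
  finally show ?thesis .
qed

text \<open>
Player 2 mixes up to a stage \<open>m\<close> after which, had he kept mixing, hardly any absorption would
remain, and then plays \<open>L\<close>. Wins before \<open>m\<close> cost at most the share \<open>\<eta>\<close> of an absorption
probability of at most 1. In the window of length \<open>n\<close> after \<open>m\<close>, playing \<open>L\<close> throughout is something
that the mixture does with probability \<open>\<eta> ^ n\<close>, so the switch multiplies the chance of a win by at
most \<open>1 / \<eta> ^ n\<close>. Since \<open>n\<close> is fixed beforehand, \<open>m\<close> can be taken so late that this factor is
harmless.
\<close>

lemma big_match_late_average_small: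
  fixes \<eta> :: real
  assumes \<eta>: "0 < \<eta>" "\<eta> \<le> 1" and n: "0 < n" and "0 < \<delta>"
  shows "\<exists>\<tau> m. (LINT x | big_match.play_measure Omega \<sigma> \<tau>.
            1 / real n * (\<Sum>i = m + 1..m + n. big_match.stage_payoff i x)) \<le> \<eta> + \<delta>"
proof -
  let ?mix = "\<lambda>_ :: (bm_state, bm_action1, bm_action2) history. mix_LR \<eta>"
  define absorb where "absorb s =
    measure (big_match.triple_law Omega \<sigma> ?mix s) {(Omega, T, L), (Omega, T, R)}" for s
  have absorb_nonneg: "0 \<le> absorb s" for s
    by (simp add: absorb_def)
  have absorb_le_1: "(\<Sum>s<k. absorb s) \<le> 1" for k
    unfolding absorb_def by (rule big_match_T_at_most_once)
  then have "summable absorb"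
    by (intro summableI_nonneg_bounded[of absorb 1] absorb_nonneg)
  moreover have "0 < \<eta> ^ n * \<delta>"
    using \<eta> \<open>0 < \<delta>\<close> by simp
  ultimately obtain m where "norm (sum absorb {m..<m + n}) < \<eta> ^ n * \<delta>"
    unfolding summable_Cauchy by blast
  then have tail: "sum absorb {m..<m + n} \<le> \<eta> ^ n * \<delta>"
    by simp
  define \<tau> :: "(bm_state, bm_action1, bm_action2, bm_action2) strategy"
    where "\<tau> h = (if length (fst h) < m then mix_LR \<eta> else return_pmf L)" for h
  define win where "win s = pmf (big_match.triple_law Omega \<sigma> \<tau> s) (Omega, T, L)" for s
  \<comment> \<open>During the first m stages the two strategies of Player 2 agree; from then on the mixture plays L with probability \<open>\<eta>\<close>.\<close>
  have dom: "(\<Prod>t\<le>s. if t < m then 1 else \<eta>) * win s \<le> \<eta> * absorb s" for s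
  proof -
    have "(if length l < m then 1 else \<eta>) * pmf (\<tau> (l, k)) j \<le> pmf (mix_LR \<eta>) j" for l k j
      using \<eta> by (cases j) (auto simp: \<tau>_def pmf_mix_LR)
    then have "(\<Prod>t\<le>s. if t < m then 1 else \<eta>) * win s
        \<le> pmf (big_match.triple_law Omega \<sigma> ?mix s) (Omega, T, L)"
      using \<eta> unfolding win_def by (intro big_match.pmf_triple_law_dominated) auto
    then show ?thesis
      using \<eta> by (simp add: win_fraction_of_stationary_mix absorb_def)
  qed
  have early: "win s \<le> \<eta> * absorb s" if "s < m" for s
  proof -
    have "(\<Prod>t\<le>s. if t < m then 1 else \<eta>) = 1"
      using that by (intro prod.neutral) auto
    with dom[of s] show ?thesis by simp
  qed
  have late: "\<eta> ^ n * win s \<le> absorb s" if s: "m \<le> s" "s < m + n" for s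
  proof -
    have "(\<Prod>t\<le>s. if t < m then 1 else \<eta>) = (\<Prod>t\<in>{m..s}. \<eta>)"
      by (intro prod.mono_neutral_cong_right) auto
    also have "\<eta> ^ n \<le> \<dots>"
      using s \<eta> by (simp add: power_decreasing)
    finally have "\<eta> ^ n * win s \<le> (\<Prod>t\<le>s. if t < m then 1 else \<eta>) * win s"
      by (intro mult_right_mono) (auto simp: win_def)
    also note dom[of s]
    also have "\<eta> * absorb s \<le> absorb s"
      using \<eta> absorb_nonneg[of s] by (simp add: mult_left_le_one_le)
    finally show ?thesis .
  qed
  have "(\<Sum>s<m. win s) \<le> \<eta> * (\<Sum>s<m. absorb s)"
    unfolding sum_distrib_left by (intro sum_mono early) simp
  also have "\<dots> \<le> \<eta>"
    using \<eta> absorb_le_1[of m] by simp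
  finally have early_total: "(\<Sum>s<m. win s) \<le> \<eta>" .
  have "\<eta> ^ n * (\<Sum>s = m..<m + n. win s) \<le> sum absorb {m..<m + n}"
    unfolding sum_distrib_left by (intro sum_mono late) auto
  also note tail
  finally have late_total: "(\<Sum>s = m..<m + n. win s) \<le> \<delta>"
    using \<eta> by simp
  have "(LINT x | big_match.play_measure Omega \<sigma> \<tau>.
            1 / real n * (\<Sum>i = m + 1..m + n. big_match.stage_payoff i x)) \<le> (\<Sum>s<m + n. win s)"
    unfolding win_def by (rule big_match_average_le_wins[OF n]) (simp add: \<tau>_def)
  also have "\<dots> = (\<Sum>s<m. win s) + (\<Sum>s = m..<m + n. win s)"
    using sum.atLeastLessThan_concat[of 0 m "m + n" win] by (simp add: lessThan_atLeast0)
  finally show ?thesis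
    using early_total late_total by (intro exI[of _ \<tau>] exI[of _ m]) linarith
qed

theorem proposition4:
  fixes \<alpha> :: real
  assumes "\<alpha> > 0"
  shows "\<not> stochastic_game.guarantees_uniformly_general bm_payoff bm_transition Omega \<alpha>"
proof
  assume "big_match.guarantees_uniformly_general Omega \<alpha>"
  moreover have "\<alpha> / 2 > 0"
    using assms by simp
  ultimately obtain \<sigma> N where "N \<ge> 1" and \<sigma>: "\<And>\<tau> n nbar. n \<ge> N \<Longrightarrow>
      (LINT x | big_match.play_measure Omega \<sigma> \<tau>.
         1 / real n * (\<Sum>m = nbar + 1..nbar + n. big_match.stage_payoff m x)) \<ge> \<alpha> - \<alpha> / 2"
    unfolding big_match.guarantees_uniformly_general_def by blast
  define \<eta> where "\<eta> = min 1 (\<alpha> / 8)"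
  have \<eta>: "0 < \<eta>" "\<eta> \<le> 1" "\<eta> \<le> \<alpha> / 8"
    using assms by (auto simp: \<eta>_def)
  obtain \<tau> nbar where "(LINT x | big_match.play_measure Omega \<sigma> \<tau>.
      1 / real N * (\<Sum>m = nbar + 1..nbar + N. big_match.stage_payoff m x)) \<le> \<eta> + \<alpha> / 8"
    using big_match_late_average_small[of \<eta> N "\<alpha> / 8" \<sigma>] \<eta> \<open>N \<ge> 1\<close> assms by auto
  with \<sigma>[OF order_refl, of \<tau> nbar] \<eta>(3) assms show False
    by linarith
qed

end
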